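(* Let $R$ be a $*$-reducing ring and let $p, q \in R$ be projections such that $1-pq \in R^{\dag}$. Write $\overline{p} = 1-p$ and $\overline{q} = 1-q$. Then: (1) $\overline{q}p \in R^{\dag}$, $(\overline{q}p)^{\dag} = (1-pq)^{\dag}p\overline{q}$, and this element is an idempotent; (2) $(\overline{q}p)^{\dag}R = pR\cap (\overline{p}R+\overline{q}R)$; (3) $[1-(\overline{q}p)^{\dag}]R = (\overline{p}R\cap\overline{q}R)\oplus^{\bot} qR$.
   Context: $R$ is an associative ring with unity and an involution $a\mapsto a^*$, i.e. $(a^* )^*=a$, $(a+b)^*=a^*+b^*$, $(ab)^*=b^*a^*$. $R$ is $*$-reducing if $a^*a=0$ implies $a=0$ for all $a\in R$. An element $a\in R$ is Moore-Penrose invertible (written $a\in R^{\dag}$) if there is $b\in R$ with $aba=a$, $bab=b$, $(ab)^*=ab$, $(ba)^*=ba$; such $b$ is unique and denoted $a^{\dag}$. A projection is an element $p$ with $p^2=p=p^*$. For $x\in R$, $xR$ is the right ideal generated by $x$. For subsets $X,Y\subseteq R$, $X\bot Y$ means $y^*x=0$ for all $x\in X$, $y\in Y$. For right ideals $X,Y,Z$, the equality $Z = X\oplus^{\bot}Y$ means $Z=X+Y$ and $X\bot Y$ (in a $*$-reducing ring, $X\bot Y$ implies $X\cap Y=\{0\}$). *)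

theory Defs
  imports "HOL-Library.Set_Algebras"
begin

(* The sort {ring, monoid_mult} is that of associative unital rings.  In contrast to ring_1 it
   does not exclude the zero ring. *)
class involution_ring = ring + monoid_mult +
  fixes star :: "'a \<Rightarrow> 'a"
  assumes star_star [simp]: "star (star a) = a"
    and star_add: "star (a + b) = star a + star b"
    and star_mult: "star (a * b) = star b * star a"

class star_reducing_ring = involution_ring +
  assumes star_reducing: "star a * a = 0 \<Longrightarrow> a = 0"

definition is_mp_inverse :: "'a::involution_ring \<Rightarrow> 'a \<Rightarrow> bool" where
  "is_mp_inverse a b \<longleftrightarrow>
     a * b * a = a \<and> b * a * b = b \<and> star (a * b) = a * b \<and> star (b * a) = b * a"

definition mp_invertible :: "'a::involution_ring \<Rightarrow> bool" where
  "mp_invertible a \<longleftrightarrow> (\<exists>b. is_mp_inverse a b)"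

(* Meaningful only if mp_invertible a holds. *)
definition mp_inv :: "'a::involution_ring \<Rightarrow> 'a" where
  "mp_inv a = (THE b. is_mp_inverse a b)"

lemma is_mp_inverse_unique:
  assumes "is_mp_inverse a b" "is_mp_inverse a c"
  shows "b = c"
proof -
  note b = assms(1)[unfolded is_mp_inverse_def]
  note c = assms(2)[unfolded is_mp_inverse_def]
  have "a * b = star (a * b)" using b by simp
  also have "\<dots> = star (a * c * (a * b))" using c by (simp add: mult.assoc[symmetric])
  also have "\<dots> = a * b * (a * c)" using b c by (simp only: star_mult[of "a * c" "a * b"])
  also have "\<dots> = a * c" using b by (simp add: mult.assoc[symmetric])
  finally have ab: "a * b = a * c" .
  have "b * a = star (b * a)" using b by simp
  also have "\<dots> = star (b * a * (c * a))" using c by (simp add: mult.assoc)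
  also have "\<dots> = c * a * (b * a)" using b c by (simp only: star_mult[of "b * a" "c * a"])
  also have "\<dots> = c * a" using b by (simp add: mult.assoc)
  finally have ba: "b * a = c * a" .
  have "b = b * a * b" using b by simp
  also have "\<dots> = c * (a * b)" by (simp add: ba mult.assoc)
  also have "\<dots> = c * a * c" by (simp add: ab mult.assoc)
  finally show ?thesis using c by simp
qed

lemma mp_inv_eqI: "is_mp_inverse a b \<Longrightarrow> mp_inv a = b"
  unfolding mp_inv_def by (blast intro: the_equality is_mp_inverse_unique)

definition projection :: "'a::involution_ring \<Rightarrow> bool" where
  "projection p \<longleftrightarrow> p * p = p \<and> star p = p"

definition idempotent :: "'a::involution_ring \<Rightarrow> bool" where
  "idempotent e \<longleftrightarrow> e * e = e"

definition right_ideal_gen :: "'a::involution_ring \<Rightarrow> 'a set" where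
  "right_ideal_gen x = {x * r | r. True}"

definition orth :: "'a::involution_ring set \<Rightarrow> 'a set \<Rightarrow> bool" where
  "orth X Y \<longleftrightarrow> (\<forall>x\<in>X. \<forall>y\<in>Y. star y * x = 0)"

(* The sum of sets is elementwise, as in Set_Algebras. *)
definition is_orth_sum :: "'a::involution_ring set \<Rightarrow> 'a set \<Rightarrow> 'a set \<Rightarrow> bool" where
  "is_orth_sum Z X Y \<longleftrightarrow> Z = X + Y \<and> orth X Y"

lemma orth_Int:
  fixes X Y :: "'a::star_reducing_ring set"
  assumes "orth X Y" "x \<in> X" "x \<in> Y"
  shows "x = 0"
  using assms unfolding orth_def by (blast intro: star_reducing)

end

theory Submission
  imports Defs
begin

text \<open>
  Put \<open>a = 1 - p * q\<close>, let \<open>b\<close> be the Moore-Penrose inverse of \<open>a\<close>, and let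
  \<open>d = (1 - q) * p\<close>. The ring being \<open>*\<close>-reducing, an element annihilated on the left by \<open>a\<close> is
  fixed by both \<open>p\<close> and \<open>q\<close>, and so is one annihilated by \<open>star a = 1 - q * p\<close>. Hence the two
  projections \<open>1 - b * a\<close> and \<open>1 - a * b\<close> are the same projection \<open>e\<close>, whose right ideal is
  \<open>pR \<inter> qR\<close>, and \<open>b\<close> is a commuting inverse of \<open>a\<close> up to \<open>e\<close>.

  Everything else is computation with \<open>c = b * p * (1 - q)\<close>. Since \<open>p * (1 - q) = p * a\<close>, one has
  \<open>c = b * p * a\<close>, which makes \<open>c\<close> idempotent. The intertwining relation \<open>a * p = p * star a\<close> passes
  to the inverses as \<open>b * p = p * star b\<close>, which makes \<open>d * c\<close> self-adjoint, while
  \<open>c * d = p - e\<close>. So \<open>c\<close> is the Moore-Penrose inverse of \<open>d\<close>. The two equalities of right ideals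
  follow: \<open>cR = (p - e)R\<close>, and the part of \<open>1 - c\<close> lying in \<open>(1 - q)R\<close>, namely
  \<open>(1 - q) - d * c\<close>, is annihilated on the left by \<open>p\<close>.
\<close>

section \<open>Involutions, projections and the right ideals they generate\<close>

lemma star_zero [simp]: "star (0::'a::involution_ring) = 0"
  using star_add[of "0::'a" 0] by simp

lemma star_minus: "star (- x) = - star (x::'a::involution_ring)"
proof -
  have "star (- x) + star x = 0"
    by (simp flip: star_add)
  then show ?thesis
    by (simp add: eq_neg_iff_add_eq_0)
qed

lemma star_diff: "star (x - y) = star x - star (y::'a::involution_ring)"
  using star_add[of x "- y"] by (simp add: star_minus)

lemma star_one [simp]: "star (1::'a::involution_ring) = 1"
  using star_mult[of "star 1" "1::'a"] by simp

lemma projection_compl: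
  assumes "projection (p::'a::involution_ring)"
  shows "projection (1 - p)"
  using assms by (simp add: projection_def star_diff algebra_simps)

lemma mem_right_ideal_gen_idem_iff:
  fixes x p :: "'a::involution_ring"
  assumes "p * p = p"
  shows "x \<in> right_ideal_gen p \<longleftrightarrow> p * x = x"
proof
  assume "x \<in> right_ideal_gen p"
  then obtain r where "x = p * r"
    by (auto simp: right_ideal_gen_def)
  then show "p * x = x"
    using assms by (simp flip: mult.assoc)
next
  assume "p * x = x"
  then show "x \<in> right_ideal_gen p"
    unfolding right_ideal_gen_def by (metis (mono_tags, lifting) mem_Collect_eq)
qed

section \<open>The Moore-Penrose inverse of \<open>1 - p * q\<close>\<close>

text \<open>This is the only place where the \<open>*\<close>-reducing property enters.\<close>

lemma fixed_by_projection_product: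
  fixes x :: "'a::star_reducing_ring"
  assumes p: "projection p" and q: "projection q" and x: "p * q * x = x"
  shows "p * x = x" and "q * x = x"
proof -
  have pp: "p * p = p" "star p = p" and qq: "q * q = q" "star q = q"
    using p q by (auto simp: projection_def)
  show px: "p * x = x"
    using x pp by (metis mult.assoc)
  have xp: "star x * p = star x"
    using px pp by (metis star_mult)
  have "star x * q * x = star x * (p * q * x)"
    using xp by (metis mult.assoc)
  then have "star x * q * x = star x * x"
    using x by simp
  then have "star x * (1 - q) * x = 0"
    by (simp add: algebra_simps)
  moreover have "star ((1 - q) * x) * ((1 - q) * x) = star x * (1 - q) * x"
    using projection_compl[OF q] by (metis mult.assoc projection_def star_mult)
  ultimately have "(1 - q) * x = 0"
    by (metis star_reducing)
  then show "q * x = x"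
    by (simp add: algebra_simps)
qed

context
  fixes p q b :: "'a::star_reducing_ring"
  assumes p: "projection p" and q: "projection q"
    and b: "is_mp_inverse (1 - p * q) b"
begin

private lemma pp: "p * p = p" "star p = p" and qq: "q * q = q" "star q = q"
  using p q by (auto simp: projection_def)

private lemma star_factor: "star (1 - p * q) = 1 - q * p"
  by (simp add: star_diff star_mult pp qq)

text \<open>The projection \<open>e\<close> with right ideal \<open>pR \<inter> qR\<close>, as the defect of \<open>b\<close> from being a
  right inverse of \<open>1 - p * q\<close>.\<close>

private definition e where "e = 1 - (1 - p * q) * b"

private lemma e_commuting: "b * (1 - p * q) = 1 - e"
  and e_fixed: "p * e = e" "q * e = e" "e * p = e" "e * q = e"
  and star_e: "star e = e"
proof -
  let ?a = "1 - p * q"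
  define f where "f = 1 - b * ?a"
  have mp: "?a * b * ?a = ?a" "star (?a * b) = ?a * b" "star (b * ?a) = b * ?a"
    using b by (auto simp: is_mp_inverse_def)
  show se: "star e = e"
    by (simp add: e_def star_diff mp)
  have sf: "star f = f"
    by (simp add: f_def star_diff mp)
  have "?a * f = 0"
    by (simp add: f_def right_diff_distrib[of ?a 1] mp flip: mult.assoc)
  then have "p * q * f = f"
    by (simp add: algebra_simps)
  from fixed_by_projection_product[OF p q this] have f: "p * f = f" "q * f = f" .
  have "e * ?a = 0"
    by (simp add: e_def left_diff_distrib[of 1 "?a * b"] mp)
  then have "star ?a * e = 0"
    by (metis se star_mult star_zero)
  then have "q * p * e = e"
    by (simp add: star_factor algebra_simps)
  from fixed_by_projection_product[OF q p this] show e: "p * e = e" "q * e = e"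
    by auto
  show "e * p = e" "e * q = e"
    using e se pp qq by (metis star_mult)+
  \<comment> \<open>Both \<open>e\<close> and \<open>f\<close> are fixed by \<open>p\<close> and \<open>q\<close>, hence killed by \<open>?a\<close> and \<open>star ?a\<close>; so each absorbs
    the other, and \<open>e = f\<close>.\<close>
  have "f * e = e"
    using e by (simp add: f_def left_diff_distrib mult.assoc)
  moreover have "f * e = f"
  proof -
    have "star ?a * f = 0"
      using f by (simp add: star_factor left_diff_distrib mult.assoc)
    then have "f * ?a = 0"
      by (metis sf star_mult star_star star_zero)
    then show ?thesis
      by (simp add: e_def right_diff_distrib flip: mult.assoc)
  qed
  ultimately show "b * ?a = 1 - e"
    by (simp add: f_def)
qed

private lemma be: "b * e = 0" and eb: "e * b = 0"
proof -
  have bab: "b * (1 - p * q) * b = b"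
    using b by (simp add: is_mp_inverse_def)
  then show "e * b = 0"
    by (simp add: e_commuting left_diff_distrib)
  from bab show "b * e = 0"
    by (simp add: e_def right_diff_distrib[of b 1] flip: mult.assoc)
qed

text \<open>The relation \<open>(1 - p * q) * p = p * star (1 - p * q)\<close> carried over to the inverses: multiply it
  by \<open>b\<close> on the left and by \<open>star b\<close> on the right.\<close>

private lemma intertwine: "b * p = p * star b"
proof -
  let ?a = "1 - p * q"
  have "?a * p = p * star ?a"
    by (simp add: star_factor algebra_simps)
  then have "b * (?a * p) * star b = b * (p * star ?a) * star b"
    by simp
  moreover have "b * (?a * p) * star b = (1 - e) * p * star b"
    by (simp add: e_commuting flip: mult.assoc)
  moreover have "(1 - e) * p * star b = p * star b"
    using be by (simp add: left_diff_distrib e_fixed) (metis star_e star_mult star_zero)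
  moreover have "b * (p * star ?a) * star b = b * p * star (b * ?a)"
    by (simp add: star_mult mult.assoc)
  moreover have "star (b * ?a) = 1 - e"
    by (simp only: e_commuting star_diff star_e star_one)
  moreover have "b * p * (1 - e) = b * p"
    by (simp add: right_diff_distrib mult.assoc e_fixed be)
  ultimately show ?thesis
    by simp
qed

section \<open>The Moore-Penrose inverse of \<open>(1 - q) * p\<close>\<close>

text \<open>The Moore-Penrose inverse \<open>c\<close> of the element \<open>d\<close> defined next.\<close>

private definition c where "c = b * p * (1 - q)"

private definition d where "d = (1 - q) * p"

private lemma c_eq: "c = b * p * (1 - p * q)"
  by (simp add: c_def right_diff_distrib mult.assoc) (simp add: pp flip: mult.assoc)

private lemma pc: "p * c = c"
  by (simp add: c_def intertwine pp flip: mult.assoc)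

private lemma cq: "c * q = 0"
  by (simp add: c_def left_diff_distrib mult.assoc qq)

private lemma cd: "c * d = p - e"
proof -
  have "c * d = b * p * (1 - q) * p"
    by (simp add: c_def d_def mult.assoc)
      (simp add: projection_compl[OF q, unfolded projection_def] flip: mult.assoc)
  also have "\<dots> = b * (1 - p * q) * p"
    by (simp add: algebra_simps pp)
  finally show ?thesis
    by (simp add: e_commuting left_diff_distrib e_fixed)
qed

private lemma dc: "d * c = (1 - q) * c"
  by (simp add: d_def mult.assoc pc)

private lemma ec: "e * c = 0"
  by (simp add: c_def eb flip: mult.assoc)

private lemma c_idempotent: "c * c = c"
proof -
  have "c * c = b * p * ((1 - p * q) * b) * p * (1 - p * q)"
    by (simp add: c_eq mult.assoc)
  also have "(1 - p * q) * b = 1 - e"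
    by (simp add: e_def)
  also have "b * p * (1 - e) * p = b * p"
    by (simp add: algebra_simps e_fixed pp be)
  finally show ?thesis
    by (simp add: c_eq)
qed

private lemma dc_self_adjoint: "star (d * c) = d * c"
proof -
  have "star (p * star b) = b * p"
    by (simp add: star_mult pp)
  then have "star (b * p) = b * p"
    by (simp add: intertwine)
  moreover have "d * c = (1 - q) * (b * p) * (1 - q)"
    unfolding dc by (simp add: c_def mult.assoc)
  moreover have "star (1 - q) = 1 - q"
    by (simp add: star_diff qq)
  ultimately show ?thesis
    by (simp add: star_mult mult.assoc)
qed

private lemma is_mp_inverse_c: "is_mp_inverse d c"
proof -
  have "d * c * d = d"
    by (simp add: mult.assoc cd) (simp add: d_def algebra_simps pp e_fixed)
  moreover have "c * d * c = c"
    by (simp add: cd left_diff_distrib pc ec)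
  ultimately show ?thesis
    by (simp add: is_mp_inverse_def dc_self_adjoint cd star_diff pp star_e)
qed

section \<open>The right ideals generated by the inverse and by its complement\<close>

private lemma mp_inverse_range:
  "right_ideal_gen c = right_ideal_gen p \<inter> (right_ideal_gen (1 - p) + right_ideal_gen (1 - q))"
proof (intro equalityI subsetI)
  fix x assume "x \<in> right_ideal_gen c"
  then have cx: "c * x = x"
    by (simp add: mem_right_ideal_gen_idem_iff c_idempotent)
  then have px: "p * x = x"
    by (metis pc mult.assoc)
  have ex: "e * x = 0"
    by (metis cx ec mult.assoc mult_zero_left)
  have "(1 - p * q) * b = 1 - e"
    by (simp add: e_def)
  then have "p - e = (1 - p * q) * b * p"
    by (simp add: left_diff_distrib e_fixed)
  then have pe: "p - e = (1 - p * q) * p * star b"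
    by (simp add: intertwine mult.assoc)
  let ?y = "p * star b * x"
  have "x = (p - e) * x"
    by (simp add: left_diff_distrib px ex)
  also have "\<dots> = p * (1 - q) * ?y"
    by (simp add: pe algebra_simps) (simp add: pp flip: mult.assoc)
  \<comment> \<open>Replacing the leading \<open>p\<close> by \<open>1 - (1 - p)\<close> splits the element.\<close>
  also have "\<dots> = (1 - p) * (- (1 - q) * ?y) + (1 - q) * ?y"
    by (simp add: algebra_simps)
  finally have "x \<in> right_ideal_gen (1 - p) + right_ideal_gen (1 - q)"
    unfolding right_ideal_gen_def set_plus_def by blast
  with px show "x \<in> right_ideal_gen p \<inter> (right_ideal_gen (1 - p) + right_ideal_gen (1 - q))"
    by (simp add: mem_right_ideal_gen_idem_iff pp)
next
  fix x assume x: "x \<in> right_ideal_gen p \<inter> (right_ideal_gen (1 - p) + right_ideal_gen (1 - q))"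
  then have px: "p * x = x"
    by (simp add: mem_right_ideal_gen_idem_iff pp)
  from x obtain y z where "x = (1 - p) * y + (1 - q) * z"
    unfolding right_ideal_gen_def set_plus_def by blast
  moreover have "e * (1 - p) = 0" "e * (1 - q) = 0"
    by (simp_all add: right_diff_distrib e_fixed)
  ultimately have "e * x = 0"
    by (simp add: distrib_left flip: mult.assoc)
  then have "x = c * (d * x)"
    by (simp add: cd left_diff_distrib px flip: mult.assoc)
  then show "x \<in> right_ideal_gen c"
    unfolding right_ideal_gen_def by blast
qed

private lemma mp_inverse_compl_range:
  "is_orth_sum (right_ideal_gen (1 - c))
     (right_ideal_gen (1 - p) \<inter> right_ideal_gen (1 - q)) (right_ideal_gen q)"
proof -
  have idem: "(1 - p) * (1 - p) = 1 - p" "(1 - q) * (1 - q) = 1 - q"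
      "(1 - c) * (1 - c) = 1 - c"
    by (simp_all add: algebra_simps pp qq c_idempotent)
  have memp: "x \<in> right_ideal_gen (1 - p) \<longleftrightarrow> p * x = 0" for x
    by (simp add: mem_right_ideal_gen_idem_iff[OF idem(1)] left_diff_distrib)
  have memq: "x \<in> right_ideal_gen (1 - q) \<longleftrightarrow> q * x = 0" for x
    by (simp add: mem_right_ideal_gen_idem_iff[OF idem(2)] left_diff_distrib)
  have memc: "x \<in> right_ideal_gen (1 - c) \<longleftrightarrow> c * x = 0" for x
    by (simp add: mem_right_ideal_gen_idem_iff[OF idem(3)] left_diff_distrib)
  have "x \<in> right_ideal_gen (1 - p) \<inter> right_ideal_gen (1 - q) + right_ideal_gen q"
    if "x \<in> right_ideal_gen (1 - c)" for x
  proof -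
    have cx: "c * x = 0"
      using that by (simp add: memc)
    \<comment> \<open>\<open>star d * (d * c) = star (d * c * d) = star d\<close>, so \<open>star d * x\<close> vanishes with \<open>c * x\<close>\<close>
    have "star d * (d * c) = star d"
      using is_mp_inverse_c by (metis dc_self_adjoint is_mp_inverse_def star_mult)
    then have "star d * x = 0"
      by (metis cx mult.assoc mult_zero_right)
    then have "p * ((1 - q) * x) = 0"
      by (simp add: d_def star_mult star_diff pp qq mult.assoc)
    moreover have "q * ((1 - q) * x) = 0"
      by (simp add: right_diff_distrib qq flip: mult.assoc)
    ultimately have "(1 - q) * x \<in> right_ideal_gen (1 - p) \<inter> right_ideal_gen (1 - q)"
      by (simp add: memp memq)
    moreover have "q * x \<in> right_ideal_gen q"
      unfolding right_ideal_gen_def by blast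
    ultimately have "(1 - q) * x + q * x
        \<in> right_ideal_gen (1 - p) \<inter> right_ideal_gen (1 - q) + right_ideal_gen q"
      by (rule set_plus_intro)
    then show ?thesis
      by (simp add: left_diff_distrib)
  qed
  moreover have "x \<in> right_ideal_gen (1 - c)"
    if x: "x \<in> right_ideal_gen (1 - p) \<inter> right_ideal_gen (1 - q) + right_ideal_gen q" for x
  proof -
    from x obtain y r where y: "p * y = 0" "q * y = 0" and x: "x = y + q * r"
      unfolding set_plus_def by (auto simp: memp memq) (auto simp: right_ideal_gen_def)
    have "c * y = 0"
      by (simp add: c_def mult.assoc left_diff_distrib y)
    moreover have "c * (q * r) = 0"
      by (simp add: cq flip: mult.assoc)
    ultimately show ?thesis
      by (simp add: memc x distrib_left)
  qed
  ultimately have "right_ideal_gen (1 - c)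
      = right_ideal_gen (1 - p) \<inter> right_ideal_gen (1 - q) + right_ideal_gen q"
    by blast
  moreover have "orth (right_ideal_gen (1 - p) \<inter> right_ideal_gen (1 - q)) (right_ideal_gen q)"
    unfolding orth_def
  proof (intro ballI)
    fix x y
    assume "x \<in> right_ideal_gen (1 - p) \<inter> right_ideal_gen (1 - q)" "y \<in> right_ideal_gen q"
    then have "q * x = 0" "q * y = y"
      by (simp_all add: memq mem_right_ideal_gen_idem_iff qq)
    then show "star y * x = 0"
      by (metis mult.assoc mult_zero_right qq(2) star_mult)
  qed
  ultimately show ?thesis
    by (simp add: is_orth_sum_def)
qed

lemmas mp_inverse_compl_mult =
  is_mp_inverse_c[unfolded c_def d_def]
  c_idempotent[unfolded c_def]
  mp_inverse_range[unfolded c_def]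
  mp_inverse_compl_range[unfolded c_def]

end

theorem theorem8:
  fixes p q :: "'a::star_reducing_ring"
  assumes "projection p" and "projection q"
    and "mp_invertible (1 - p * q)"
  shows "(mp_invertible ((1 - q) * p)
        \<and> mp_inv ((1 - q) * p) = mp_inv (1 - p * q) * p * (1 - q)
        \<and> idempotent (mp_inv ((1 - q) * p)))
    \<and> right_ideal_gen (mp_inv ((1 - q) * p))
        = right_ideal_gen p \<inter> (right_ideal_gen (1 - p) + right_ideal_gen (1 - q))
    \<and> is_orth_sum (right_ideal_gen (1 - mp_inv ((1 - q) * p)))
        (right_ideal_gen (1 - p) \<inter> right_ideal_gen (1 - q)) (right_ideal_gen q)"
proof -
  obtain b where b: "is_mp_inverse (1 - p * q) b"
    using assms(3) by (auto simp: mp_invertible_def)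
  note facts = mp_inverse_compl_mult[OF assms(1,2) b]
  have "mp_inv (1 - p * q) = b" "mp_inv ((1 - q) * p) = b * p * (1 - q)"
    using b facts(1) by (auto intro: mp_inv_eqI)
  moreover have "mp_invertible ((1 - q) * p)"
    using facts(1) unfolding mp_invertible_def by blast
  ultimately show ?thesis
    unfolding idempotent_def using facts(2-4) by simp
qed

end
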